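(* Let $k\geq 0$ be an integer. Every graph that has a cylindrical semi-bar $k$-visibility representation in which all semi-bars have different lengths has a maximal $(k+2)$-quasiplanar convex geometric representation.
   Context: A cylindrical semi-bar $k$-visibility representation of a graph $G=(V,E)$ is a collection $\{s_v\}_{v\in V}$ of pairwise disjoint segments (semi-bars) in $\mathbb{R}^3$ parallel to the $x$-axis with left endpoints on the circle $\{(0,y,z): y^2+z^2=1\}$, such that for all $a,b\in V$, $\{a,b\}\in E$ if and only if there is a circular arc on the surface of the cylinder $y^2+z^2=1$ lying in a plane parallel to the $yz$-plane (a sightline) which intersects $s_a$, $s_b$, and at most $k$ other semi-bars. A $(k+2)$-quasiplanar convex geometric representation of a graph is a drawing of it in the plane with vertices as points in convex position and edges as straight segments such that no $k+2$ edges are pairwise crossing. Such a representation is maximal if adding any further straight segment between two of its (non-adjacent) vertices creates $k+2$ pairwise crossing edges. *)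

theory Defs
  imports "HOL-Analysis.Analysis"
begin

text \<open>Edges are two-element sets of vertices. Points of the plane and of 3-space are
  tuples of reals; the library makes these product types Euclidean spaces.\<close>

definition simple_graph :: "'a set \<Rightarrow> 'a set set \<Rightarrow> bool" where
  "simple_graph V E \<longleftrightarrow> finite V \<and> E \<subseteq> {e. e \<subseteq> V \<and> card e = 2}"

text \<open>In \<open>semi_bar q r\<close>, \<open>q\<close> holds the \<open>y\<close>- and \<open>z\<close>-coordinates of the left endpoint
  and \<open>r\<close> is the length.\<close>

definition semi_bar :: "real \<times> real \<Rightarrow> real \<Rightarrow> (real \<times> real \<times> real) set" where
  "semi_bar q r = closed_segment (0, fst q, snd q) (r, fst q, snd q)"

text \<open>The bound on the angles makes the arc proper, that is, not the full circle. With
  finitely many disjoint semi-bars this loses nothing: a small piece of the circle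
  that misses all of them can be cut out.\<close>

definition sightline :: "(real \<times> real \<times> real) set \<Rightarrow> bool" where
  "sightline A \<longleftrightarrow>
     (\<exists>c \<alpha> \<beta>. \<alpha> < \<beta> \<and> \<beta> < \<alpha> + 2 * pi \<and> A = {(c, cos t, sin t) | t. \<alpha> \<le> t \<and> t \<le> \<beta>})"

definition cyl_semi_bar_visibility_rep ::
    "nat \<Rightarrow> 'a set \<Rightarrow> 'a set set \<Rightarrow> ('a \<Rightarrow> real \<times> real) \<Rightarrow> ('a \<Rightarrow> real) \<Rightarrow> bool" where
  "cyl_semi_bar_visibility_rep k V E p len \<longleftrightarrow>
     (\<forall>v\<in>V. (fst (p v))\<^sup>2 + (snd (p v))\<^sup>2 = 1 \<and> 0 < len v) \<and>
     disjoint_family_on (\<lambda>v. semi_bar (p v) (len v)) V \<and>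
     (\<forall>a\<in>V. \<forall>b\<in>V. a \<noteq> b \<longrightarrow>
        ({a, b} \<in> E \<longleftrightarrow>
          (\<exists>A. sightline A \<and>
               A \<inter> semi_bar (p a) (len a) \<noteq> {} \<and>
               A \<inter> semi_bar (p b) (len b) \<noteq> {} \<and>
               card {v \<in> V - {a, b}. A \<inter> semi_bar (p v) (len v) \<noteq> {}} \<le> k)))"

definition convex_position :: "(real \<times> real) set \<Rightarrow> bool" where
  "convex_position P \<longleftrightarrow> (\<forall>x\<in>P. x \<notin> convex hull (P - {x}))"

text \<open>Open segments are used because edges that merely share an endpoint do not cross.\<close>

definition edges_cross :: "('a \<Rightarrow> real \<times> real) \<Rightarrow> 'a set \<Rightarrow> 'a set \<Rightarrow> bool" where
  "edges_cross f e e' \<longleftrightarrow>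
     (\<exists>a b c d. e = {a, b} \<and> e' = {c, d} \<and>
        open_segment (f a) (f b) \<inter> open_segment (f c) (f d) \<noteq> {})"

definition has_pairwise_crossing :: "nat \<Rightarrow> ('a \<Rightarrow> real \<times> real) \<Rightarrow> 'a set set \<Rightarrow> bool" where
  "has_pairwise_crossing m f E \<longleftrightarrow> (\<exists>F\<subseteq>E. card F = m \<and> pairwise (edges_cross f) F)"

text \<open>The map \<open>f\<close> places the vertices; the edges are then drawn as the straight segments
  between their endpoints.\<close>

definition quasiplanar_convex_rep ::
    "nat \<Rightarrow> 'a set \<Rightarrow> 'a set set \<Rightarrow> ('a \<Rightarrow> real \<times> real) \<Rightarrow> bool" where
  "quasiplanar_convex_rep m V E f \<longleftrightarrow>
     inj_on f V \<and> convex_position (f ` V) \<and> \<not> has_pairwise_crossing m f E"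

definition maximal_quasiplanar_convex_rep ::
    "nat \<Rightarrow> 'a set \<Rightarrow> 'a set set \<Rightarrow> ('a \<Rightarrow> real \<times> real) \<Rightarrow> bool" where
  "maximal_quasiplanar_convex_rep m V E f \<longleftrightarrow>
     quasiplanar_convex_rep m V E f \<and>
     (\<forall>a\<in>V. \<forall>b\<in>V. a \<noteq> b \<and> {a, b} \<notin> E \<longrightarrow> has_pairwise_crossing m f (insert {a, b} E))"

end

theory Submission
  imports Defs
begin

text \<open>The circle points \<open>p v\<close> themselves serve as the convex drawing. Two vertices \<open>a\<close>, \<open>b\<close> are
  adjacent iff one of the two open arcs between them carries at most \<open>k\<close> bars longer than
  \<open>min (len a) (len b)\<close>. In a family of \<open>k + 2\<close> pairwise crossing edges, the edge containing the
  shortest bar would have an endpoint of each of the \<open>k + 1\<close> other edges on either side, all of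
  them longer. Conversely, let \<open>a\<close>, \<open>b\<close> be non-adjacent with \<open>a\<close> the shorter bar, and let
  \<open>t 0, \<dots>, t (m - 1)\<close> be the bars longer than \<open>a\<close> in cyclic order from \<open>a\<close>. Then \<open>t i\<close> sees
  \<open>t (m - k - 1 + i)\<close> across \<open>a\<close> for \<open>i \<le> k\<close>, and these \<open>k + 1\<close> edges cross each other and \<open>ab\<close>.\<close>

section \<open>Orientation, crossing segments and convex position\<close>

text \<open>Twice the signed area of the triangle \<open>a\<close>, \<open>b\<close>,
  \<open>x\<close>: positive when \<open>x\<close> lies to the left of the line directed from
  \<open>a\<close> to \<open>b\<close>, zero when it lies on it.\<close>

definition orient :: "real \<times> real \<Rightarrow> real \<times> real \<Rightarrow> real \<times> real \<Rightarrow> real" where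
  "orient a b x = (fst b - fst a) * (snd x - snd a) - (snd b - snd a) * (fst x - fst a)"

abbreviation circle_point :: "real \<Rightarrow> real \<times> real" where
  "circle_point t \<equiv> (cos t, sin t)"

lemma orient_affine:
  "orient a b ((1 - u) *\<^sub>R c + u *\<^sub>R d) = (1 - u) * orient a b c + u * orient a b d"
  by (simp add: orient_def algebra_simps)

text \<open>Product form by the double-angle formulas. It makes signs readable: for angles that
  differ by less than \<open>2 * pi\<close>, the sine of half the difference has the sign of the
  difference.\<close>

lemma orient_circle_point:
  "orient (circle_point a) (circle_point b) (circle_point x) =
     4 * sin ((b - a) / 2) * sin ((x - b) / 2) * sin ((x - a) / 2)"
proof -
  define u v where "u = (b - a) / 2" and "v = (x - b) / 2"
  have double: "2 * u = b - a" "2 * v = x - b"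
    by (simp_all add: u_def v_def)
  have "orient (circle_point a) (circle_point b) (circle_point x) =
      sin (b - a) + sin (x - b) - sin (x - a)"
    by (simp add: orient_def sin_diff algebra_simps)
  also have "\<dots> = sin (2 * u) + sin (2 * v) - sin (2 * u + 2 * v)"
    by (simp add: double)
  also have "\<dots> = sin (2 * u) * (1 - cos (2 * v)) + sin (2 * v) * (1 - cos (2 * u))"
    by (simp only: sin_add) (simp add: algebra_simps)
  also have "\<dots> = 4 * sin u * sin v * sin (u + v)"
    unfolding cos_double_sin sin_double sin_add by algebra
  also have "u + v = (x - a) / 2"
    by (simp add: u_def v_def field_simps)
  finally show ?thesis
    by (simp add: u_def v_def)
qed

text \<open>Each segment strictly separates the endpoints of the other, so the common point of the
  two lines divides both segments with weights strictly between 0 and 1.\<close>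

lemma open_segments_meet:
  assumes "orient a b c * orient a b d < 0" "orient c d a * orient c d b < 0"
  shows "open_segment a b \<inter> open_segment c d \<noteq> {}"
proof -
  have weight: "0 < x / (x - y) \<and> x / (x - y) < 1" if "x * y < 0" for x y :: real
    using that by (auto simp: mult_less_0_iff divide_simps)
  \<comment> \<open>\<open>s\<close> is the weight at which the affine function
    \<open>orient a b\<close> vanishes on the segment from \<open>c\<close> to \<open>d\<close>;
    \<open>t\<close> is the same for \<open>orient c d\<close> on the segment from \<open>a\<close>
    to \<open>b\<close>.\<close>
  define s t where "s = orient a b c / (orient a b c - orient a b d)"
    and "t = orient c d a / (orient c d a - orient c d b)"
  define D where "D = orient a b c - orient a b d"
  have D: "orient c d a - orient c d b = - D"
    by (simp add: D_def orient_def algebra_simps)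
  have "D \<noteq> 0"
    using assms(1) by (auto simp: D_def)
  have s: "s * D = orient a b c" and t: "t * D = - orient c d a"
    using \<open>D \<noteq> 0\<close> D by (simp_all add: s_def t_def D_def[symmetric])
  \<comment> \<open>After scaling by \<open>D\<close>, the common denominator of \<open>s\<close>
    and \<open>t\<close> up to sign, equality of the two points becomes a polynomial identity in
    each coordinate.\<close>
  have "D * fst ((1 - t) *\<^sub>R a + t *\<^sub>R b) = D * fst ((1 - s) *\<^sub>R c + s *\<^sub>R d)"
  proof -
    have "D * fst ((1 - t) *\<^sub>R a + t *\<^sub>R b) = D * fst a + (t * D) * (fst b - fst a)"
      by (simp add: algebra_simps)
    also have "\<dots> = D * fst c + (s * D) * (fst d - fst c)"
      unfolding s t unfolding D_def orient_def by algebra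
    finally show ?thesis
      by (simp add: algebra_simps)
  qed
  moreover have "D * snd ((1 - t) *\<^sub>R a + t *\<^sub>R b) = D * snd ((1 - s) *\<^sub>R c + s *\<^sub>R d)"
  proof -
    have "D * snd ((1 - t) *\<^sub>R a + t *\<^sub>R b) = D * snd a + (t * D) * (snd b - snd a)"
      by (simp add: algebra_simps)
    also have "\<dots> = D * snd c + (s * D) * (snd d - snd c)"
      unfolding s t unfolding D_def orient_def by algebra
    finally show ?thesis
      by (simp add: algebra_simps)
  qed
  ultimately have eq: "(1 - t) *\<^sub>R a + t *\<^sub>R b = (1 - s) *\<^sub>R c + s *\<^sub>R d"
    using \<open>D \<noteq> 0\<close> by (intro prod_eqI) simp_all
  have "a \<noteq> b" "c \<noteq> d"
    using assms by (auto simp: orient_def)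
  moreover have "0 < s" "s < 1" "0 < t" "t < 1"
    using weight assms by (auto simp: s_def t_def)
  ultimately have "(1 - t) *\<^sub>R a + t *\<^sub>R b \<in> open_segment a b"
    "(1 - s) *\<^sub>R c + s *\<^sub>R d \<in> open_segment c d"
    unfolding in_segment by blast+
  then show ?thesis
    unfolding eq by blast
qed

text \<open>The tangent at \<open>x\<close> separates: every other unit vector \<open>y\<close> has
  \<open>inner x y < 1\<close>, so the hull of the others stays in this open half-plane, while
  \<open>inner x x = 1\<close>.\<close>

lemma convex_position_unit_circle:
  assumes "\<And>x. x \<in> P \<Longrightarrow> (fst x)\<^sup>2 + (snd x)\<^sup>2 = 1"
  shows "convex_position P"
  unfolding convex_position_def
proof
  fix x assume "x \<in> P"
  have "inner x y < 1" if "y \<in> P - {x}" for y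
  proof -
    have "0 < (fst x - fst y)\<^sup>2 + (snd x - snd y)\<^sup>2"
      using that by (auto simp: sum_power2_gt_zero_iff prod_eq_iff)
    also have "\<dots> = ((fst x)\<^sup>2 + (snd x)\<^sup>2) + ((fst y)\<^sup>2 + (snd y)\<^sup>2) - 2 * inner x y"
      by (simp add: inner_prod_def power2_eq_square algebra_simps)
    also have "\<dots> = 2 - 2 * inner x y"
      using assms[of x] assms[of y] \<open>x \<in> P\<close> that by simp
    finally show ?thesis by simp
  qed
  then have "convex hull (P - {x}) \<subseteq> {y. inner x y < 1}"
    by (intro hull_minimal convex_halfspace_lt) auto
  moreover have "inner x x = 1"
    using assms[OF \<open>x \<in> P\<close>] by (simp add: inner_prod_def power2_eq_square)
  ultimately show "x \<notin> convex hull (P - {x})"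
    by auto
qed

lemma edges_cross_doubleton:
  "edges_cross f {a, b} {c, d} \<longleftrightarrow> open_segment (f a) (f b) \<inter> open_segment (f c) (f d) \<noteq> {}"
proof
  assume "edges_cross f {a, b} {c, d}"
  then obtain a' b' c' d' where "{a, b} = {a', b'}" "{c, d} = {c', d'}"
    "open_segment (f a') (f b') \<inter> open_segment (f c') (f d') \<noteq> {}"
    unfolding edges_cross_def by blast
  then show "open_segment (f a) (f b) \<inter> open_segment (f c) (f d) \<noteq> {}"
    using open_segment_commute[of "f a" "f b"] open_segment_commute[of "f c" "f d"]
    by (elim doubleton_eq_iff[THEN iffD1, THEN disjE] conjE) (simp_all only:, simp_all)
qed (unfold edges_cross_def, blast)

lemma edges_cross_commute: "edges_cross f e e' \<longleftrightarrow> edges_cross f e' e"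
  unfolding edges_cross_def by (blast intro: Int_commute)

section \<open>Arcs meeting semi-bars\<close>

lemma semi_bar_iff:
  assumes "0 < r"
  shows "(x, y, z) \<in> semi_bar q r \<longleftrightarrow> 0 \<le> x \<and> x \<le> r \<and> (y, z) = q"
proof
  assume "(x, y, z) \<in> semi_bar q r"
  then obtain u where "0 \<le> u" "u \<le> 1" "x = u * r" "(y, z) = q"
    by (cases q) (auto simp: semi_bar_def in_segment algebra_simps)
  then show "0 \<le> x \<and> x \<le> r \<and> (y, z) = q"
    using assms by (auto simp: mult_left_le_one_le)
next
  assume x: "0 \<le> x \<and> x \<le> r \<and> (y, z) = q"
  then show "(x, y, z) \<in> semi_bar q r"
    using assms by (auto simp: semi_bar_def in_segment algebra_simps intro!: exI[of _ "x / r"])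
qed

definition circle_arc :: "real \<Rightarrow> real \<Rightarrow> real \<Rightarrow> (real \<times> real \<times> real) set" where
  "circle_arc c \<alpha> \<beta> = {(c, cos t, sin t) | t. \<alpha> \<le> t \<and> t \<le> \<beta>}"

text \<open>A point of the circle determines its angle only up to full turns, so some lift of
  \<open>\<theta>\<close> has to fall into the parameter interval of the arc.\<close>

lemma arc_meets_semi_bar_iff:
  assumes "0 < r"
  shows "circle_arc c \<alpha> \<beta> \<inter> semi_bar (circle_point \<theta>) r \<noteq> {} \<longleftrightarrow>
    0 \<le> c \<and> c \<le> r \<and> (\<exists>n::int. \<alpha> \<le> \<theta> + 2 * pi * n \<and> \<theta> + 2 * pi * n \<le> \<beta>)"
proof -
  have "circle_arc c \<alpha> \<beta> \<inter> semi_bar (circle_point \<theta>) r \<noteq> {} \<longleftrightarrow>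
    0 \<le> c \<and> c \<le> r \<and> (\<exists>t. \<alpha> \<le> t \<and> t \<le> \<beta> \<and> sin t = sin \<theta> \<and> cos t = cos \<theta>)"
    using assms by (auto simp: circle_arc_def semi_bar_iff)
  then show ?thesis
    by (auto simp: sin_cos_eq_iff)
qed

lemma sightline_iff_circle_arc:
  "sightline A \<longleftrightarrow> (\<exists>c \<alpha> \<beta>. \<alpha> < \<beta> \<and> \<beta> < \<alpha> + 2 * pi \<and> A = circle_arc c \<alpha> \<beta>)"
  by (simp add: sightline_def circle_arc_def)

section \<open>Bars as angles in a window of one full turn\<close>

text \<open>The circle is cut open at the angle \<open>\<tau>\<close>, which turns cyclic order into
  linear order. Keeping \<open>\<tau>\<close> a parameter allows the cut to be placed at any chosen
  bar.\<close>

locale visibility_angles =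
  fixes k :: nat and V :: "'a set" and E :: "'a set set"
    and p :: "'a \<Rightarrow> real \<times> real" and len :: "'a \<Rightarrow> real" and \<theta> :: "'a \<Rightarrow> real" and \<tau> :: real
  assumes graph: "simple_graph V E"
    and rep: "cyl_semi_bar_visibility_rep k V E p len"
    and inj_len: "inj_on len V"
    and p_eq: "\<And>v. v \<in> V \<Longrightarrow> p v = circle_point (\<theta> v)"
    and \<theta>_ge: "\<And>v. v \<in> V \<Longrightarrow> \<tau> \<le> \<theta> v"
    and \<theta>_less: "\<And>v. v \<in> V \<Longrightarrow> \<theta> v < \<tau> + 2 * pi"
begin

text \<open>\<open>between\<close> and \<open>beyond\<close> collect the vertices on the two open
  arcs bounded by \<open>a\<close> and \<open>b\<close>; \<open>beyond\<close> belongs to the arc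
  that wraps around from the top of the angle window to its bottom.\<close>

definition between :: "'a \<Rightarrow> 'a \<Rightarrow> 'a set" where
  "between a b = {v \<in> V. min (\<theta> a) (\<theta> b) < \<theta> v \<and> \<theta> v < max (\<theta> a) (\<theta> b)}"

definition beyond :: "'a \<Rightarrow> 'a \<Rightarrow> 'a set" where
  "beyond a b = {v \<in> V. \<theta> v < min (\<theta> a) (\<theta> b) \<or> max (\<theta> a) (\<theta> b) < \<theta> v}"

text \<open>The minimum is the largest height at which a sightline can reach both bars; the bars
  counted here cannot be avoided by raising the sightline.\<close>

definition longer :: "'a \<Rightarrow> 'a \<Rightarrow> 'a set" where
  "longer a b = {v \<in> V. min (len a) (len b) < len v}"

lemma between_commute: "between a b = between b a"
  by (simp add: between_def min.commute max.commute)

lemma beyond_commute: "beyond a b = beyond b a"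
  by (simp add: beyond_def min.commute max.commute)

lemma longer_commute: "longer a b = longer b a"
  by (simp add: longer_def min.commute)

lemma finite_V: "finite V"
  using graph by (simp add: simple_graph_def)

lemma edge_cases:
  assumes "e \<in> E"
  obtains a b where "e = {a, b}" "a \<in> V" "b \<in> V" "a \<noteq> b"
  using assms graph by (auto simp: simple_graph_def card_2_iff subset_iff)

lemma edge_at:
  assumes "e \<in> E" "v \<in> e"
  obtains w where "e = {v, w}" "v \<in> V" "w \<in> V" "v \<noteq> w"
  using assms(1)
proof (rule edge_cases)
  fix a b assume "e = {a, b}" "a \<in> V" "b \<in> V" "a \<noteq> b"
  then show thesis
    using that[of a] that[of b] assms(2) by auto
qed

lemma len_pos: "v \<in> V \<Longrightarrow> 0 < len v"
  using rep by (simp add: cyl_semi_bar_visibility_rep_def)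

text \<open>Two bars at the same point of the circle would share their left endpoint.\<close>

lemma p_inj: "inj_on p V"
proof (rule inj_onI, rule ccontr)
  fix u v assume uv: "u \<in> V" "v \<in> V" "p u = p v" "u \<noteq> v"
  have "disjoint_family_on (\<lambda>v. semi_bar (p v) (len v)) V"
    using rep by (simp add: cyl_semi_bar_visibility_rep_def)
  then have "semi_bar (p u) (len u) \<inter> semi_bar (p v) (len v) = {}"
    using uv unfolding disjoint_family_on_def by blast
  moreover have "(0, fst (p w), snd (p w)) \<in> semi_bar (p w) (len w)" if "w \<in> V" for w
    using len_pos[OF that] by (subst semi_bar_iff) simp_all
  then have "(0, fst (p u), snd (p u)) \<in> semi_bar (p u) (len u) \<inter> semi_bar (p v) (len v)"
    using uv by (metis IntI)
  ultimately show False
    by blast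
qed

lemma \<theta>_inj: "inj_on \<theta> V"
  using p_inj p_eq by (auto simp: inj_on_def)

lemma \<theta>_eq_iff: "u \<in> V \<Longrightarrow> v \<in> V \<Longrightarrow> \<theta> u = \<theta> v \<longleftrightarrow> u = v"
  using \<theta>_inj by (auto simp: inj_on_def)

lemma \<theta>_diff: "u \<in> V \<Longrightarrow> v \<in> V \<Longrightarrow> \<theta> u - \<theta> v < 2 * pi"
  using \<theta>_ge[of v] \<theta>_less[of u] by simp

lemma arc_meets_bar_iff:
  "v \<in> V \<Longrightarrow> circle_arc c \<alpha> \<beta> \<inter> semi_bar (p v) (len v) \<noteq> {} \<longleftrightarrow>
    0 \<le> c \<and> c \<le> len v \<and> (\<exists>n::int. \<alpha> \<le> \<theta> v + 2 * pi * n \<and> \<theta> v + 2 * pi * n \<le> \<beta>)"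
  using arc_meets_semi_bar_iff[of "len v" c \<alpha> \<beta> "\<theta> v"] len_pos[of v] p_eq[of v] by simp

section \<open>Adjacency as a count of longer bars on one arc\<close>

text \<open>A sightline reaching both bars covers one of the two arcs at height at most the minimum,
  hence meets every longer bar there. Conversely, either arc taken at exactly that height meets,
  besides \<open>a\<close> and \<open>b\<close>, only longer bars.\<close>

lemma visible_iff_if_less:
  assumes a: "a \<in> V" and b: "b \<in> V" and less: "\<theta> a < \<theta> b"
  shows "{a, b} \<in> E \<longleftrightarrow>
    card (between a b \<inter> longer a b) \<le> k \<or> card (beyond a b \<inter> longer a b) \<le> k"
proof
  have "a \<noteq> b"
    using less by auto
  let ?c = "min (len a) (len b)"
  assume "{a, b} \<in> E"
  then obtain c \<alpha> \<beta> where \<beta>: "\<beta> < \<alpha> + 2 * pi"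
    and meets: "circle_arc c \<alpha> \<beta> \<inter> semi_bar (p a) (len a) \<noteq> {}"
      "circle_arc c \<alpha> \<beta> \<inter> semi_bar (p b) (len b) \<noteq> {}"
    and card: "card {v \<in> V - {a, b}. circle_arc c \<alpha> \<beta> \<inter> semi_bar (p v) (len v) \<noteq> {}} \<le> k"
  proof -
    obtain A where "sightline A" "A \<inter> semi_bar (p a) (len a) \<noteq> {}"
      "A \<inter> semi_bar (p b) (len b) \<noteq> {}"
      "card {v \<in> V - {a, b}. A \<inter> semi_bar (p v) (len v) \<noteq> {}} \<le> k"
      using rep a b \<open>a \<noteq> b\<close> \<open>{a, b} \<in> E\<close> unfolding cyl_semi_bar_visibility_rep_def by blast
    then show thesis
      using that unfolding sightline_iff_circle_arc by blast
  qed
  have c: "0 \<le> c" "c \<le> ?c"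
    using meets by (simp_all add: arc_meets_bar_iff a b)
  obtain m n :: int where m: "\<alpha> \<le> \<theta> a + 2 * pi * m" "\<theta> a + 2 * pi * m \<le> \<beta>"
    and n: "\<alpha> \<le> \<theta> b + 2 * pi * n" "\<theta> b + 2 * pi * n \<le> \<beta>"
    using meets by (auto simp: arc_meets_bar_iff a b)
  have seen: "card S \<le> k" if "S \<subseteq> longer a b"
    and "\<And>v. v \<in> S \<Longrightarrow> \<exists>n::int. \<alpha> \<le> \<theta> v + 2 * pi * n \<and> \<theta> v + 2 * pi * n \<le> \<beta>"
    and "a \<notin> S" "b \<notin> S" for S
  proof -
    have "S \<subseteq> {v \<in> V - {a, b}. circle_arc c \<alpha> \<beta> \<inter> semi_bar (p v) (len v) \<noteq> {}}"
    proof
      fix v assume "v \<in> S"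
      then have "v \<in> V" "c \<le> len v"
        using that(1) c by (auto simp: longer_def)
      then have "circle_arc c \<alpha> \<beta> \<inter> semi_bar (p v) (len v) \<noteq> {}"
        unfolding arc_meets_bar_iff[OF \<open>v \<in> V\<close>] using that(2)[OF \<open>v \<in> S\<close>] c by blast
      then show "v \<in> {v \<in> V - {a, b}. circle_arc c \<alpha> \<beta> \<inter> semi_bar (p v) (len v) \<noteq> {}}"
        using \<open>v \<in> V\<close> \<open>v \<in> S\<close> that(3,4) by blast
    qed
    then have "card S \<le> card {v \<in> V - {a, b}. circle_arc c \<alpha> \<beta> \<inter> semi_bar (p v) (len v) \<noteq> {}}"
      using finite_V by (intro card_mono) simp_all
    then show ?thesis
      using card by simp
  qed
  \<comment> \<open>The lifts of \<open>a\<close> and \<open>b\<close> lie less than a full turn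
    apart and \<open>\<theta> a < \<theta> b < \<theta> a + 2 * pi\<close>. So either both lifts lie
    in the same turn and the sightline spans \<open>between\<close>, or \<open>a\<close> is met one
    turn later than \<open>b\<close> and the sightline spans \<open>beyond\<close>.\<close>
  have "2 * pi * (m - n) < 2 * pi * 2" "2 * pi * (m - n) > 2 * pi * (-1)"
    using m n \<beta> less \<theta>_diff[OF b a] by (simp_all add: algebra_simps)
  then have "real_of_int (m - n) < 2" "real_of_int (m - n) > -1"
    by (simp_all only: mult_less_cancel_left_pos[of "2 * pi"] pi_gt_zero zero_less_mult_iff
        zero_less_numeral simp_thms)
  then consider "m = n" | "m = n + 1"
    by linarith
  then show "card (between a b \<inter> longer a b) \<le> k \<or> card (beyond a b \<inter> longer a b) \<le> k"
  proof cases
    case 1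
    have "card (between a b \<inter> longer a b) \<le> k"
    proof (rule seen)
      fix v assume "v \<in> between a b \<inter> longer a b"
      then show "\<exists>n::int. \<alpha> \<le> \<theta> v + 2 * pi * n \<and> \<theta> v + 2 * pi * n \<le> \<beta>"
        using 1 m n less by (intro exI[of _ n]) (auto simp: between_def)
    qed (auto simp: between_def)
    then show ?thesis ..
  next
    case 2
    have "card (beyond a b \<inter> longer a b) \<le> k"
    proof (rule seen)
      fix v assume "v \<in> beyond a b \<inter> longer a b"
      then have "v \<in> V" "\<theta> v < \<theta> a \<or> \<theta> b < \<theta> v"
        using less by (auto simp: beyond_def)
      then show "\<exists>n::int. \<alpha> \<le> \<theta> v + 2 * pi * n \<and> \<theta> v + 2 * pi * n \<le> \<beta>"
      proof (elim disjE)
        assume "\<theta> v < \<theta> a"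
        then show ?thesis
          using 2 m n \<theta>_diff[OF b \<open>v \<in> V\<close>] by (intro exI[of _ m]) (auto simp: algebra_simps)
      next
        assume "\<theta> b < \<theta> v"
        then show ?thesis
          using 2 m n \<theta>_diff[OF \<open>v \<in> V\<close> a] by (intro exI[of _ n]) (auto simp: algebra_simps)
      qed
    qed (use less in \<open>auto simp: beyond_def\<close>)
    then show ?thesis ..
  qed
next
  have "a \<noteq> b"
    using less by auto
  let ?c = "min (len a) (len b)"
  have c: "0 \<le> ?c"
    using len_pos[OF a] len_pos[OF b] by simp
  have adjacent: "{a, b} \<in> E" if "card S \<le> k" "\<alpha> < \<beta>" "\<beta> < \<alpha> + 2 * pi"
    and "\<exists>n::int. \<alpha> \<le> \<theta> a + 2 * pi * n \<and> \<theta> a + 2 * pi * n \<le> \<beta>"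
    and "\<exists>n::int. \<alpha> \<le> \<theta> b + 2 * pi * n \<and> \<theta> b + 2 * pi * n \<le> \<beta>"
    and sub: "\<And>v n::int. v \<in> V \<Longrightarrow> v \<noteq> a \<Longrightarrow> v \<noteq> b \<Longrightarrow> \<alpha> \<le> \<theta> v + 2 * pi * n \<Longrightarrow>
      \<theta> v + 2 * pi * n \<le> \<beta> \<Longrightarrow> ?c < len v \<Longrightarrow> v \<in> S" and "S \<subseteq> V" for S \<alpha> \<beta>
  proof -
    \<comment> \<open>Distinct lengths enter here: no third bar ends exactly at the height
      \<open>?c\<close>, so every other bar met at that height is strictly longer.\<close>
    have ne: "?c \<noteq> len v" if "v \<in> V" "v \<noteq> a" "v \<noteq> b" for v
      using that inj_len a b by (auto simp: inj_on_def min_def)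
    have "{v \<in> V - {a, b}. circle_arc ?c \<alpha> \<beta> \<inter> semi_bar (p v) (len v) \<noteq> {}} \<subseteq> S"
    proof
      fix v assume v: "v \<in> {v \<in> V - {a, b}. circle_arc ?c \<alpha> \<beta> \<inter> semi_bar (p v) (len v) \<noteq> {}}"
      then have "?c \<le> len v"
        and n: "\<exists>n::int. \<alpha> \<le> \<theta> v + 2 * pi * n \<and> \<theta> v + 2 * pi * n \<le> \<beta>"
        using arc_meets_bar_iff[of v ?c \<alpha> \<beta>] by blast+
      then have "?c < len v"
        using ne[of v] v by auto
      then show "v \<in> S"
        using n v sub by blast
    qed
    then have "card {v \<in> V - {a, b}. circle_arc ?c \<alpha> \<beta> \<inter> semi_bar (p v) (len v) \<noteq> {}} \<le> k"
      using \<open>card S \<le> k\<close> \<open>S \<subseteq> V\<close> finite_V by (meson card_mono finite_subset le_trans)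
    moreover have "circle_arc ?c \<alpha> \<beta> \<inter> semi_bar (p a) (len a) \<noteq> {}"
      "circle_arc ?c \<alpha> \<beta> \<inter> semi_bar (p b) (len b) \<noteq> {}"
      unfolding arc_meets_bar_iff[OF a] arc_meets_bar_iff[OF b] using that(4,5) c by auto
    moreover have "sightline (circle_arc ?c \<alpha> \<beta>)"
      using that(2,3) by (auto simp: sightline_iff_circle_arc)
    ultimately show ?thesis
      using rep a b \<open>a \<noteq> b\<close> unfolding cyl_semi_bar_visibility_rep_def by blast
  qed
  \<comment> \<open>Bounds on whole turns that leave only linear inequalities when excluding
    unwanted lifts.\<close>
  have turns: "n = 0 \<or> n \<ge> 1 \<and> 2 * pi \<le> 2 * pi * real_of_int n \<or>
      n \<le> -1 \<and> 2 * pi * real_of_int n \<le> - (2 * pi)" for n :: int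
  proof -
    consider "n = 0" | "n \<ge> 1" | "n \<le> -1" by linarith
    then show ?thesis
    proof cases
      case 2
      then have "2 * pi * 1 \<le> 2 * pi * real_of_int n"
        by (intro mult_left_mono) auto
      then show ?thesis using 2 by simp
    next
      case 3
      then have "2 * pi * real_of_int n \<le> 2 * pi * (- 1)"
        by (intro mult_left_mono) auto
      then show ?thesis using 3 by simp
    qed simp
  qed
  assume "card (between a b \<inter> longer a b) \<le> k \<or> card (beyond a b \<inter> longer a b) \<le> k"
  then show "{a, b} \<in> E"
  proof
    assume card: "card (between a b \<inter> longer a b) \<le> k"
    show ?thesis
    proof (rule adjacent[OF card])
      fix v and n :: int
      assume v: "v \<in> V" "v \<noteq> a" "v \<noteq> b" "\<theta> a \<le> \<theta> v + 2 * pi * n" "\<theta> v + 2 * pi * n \<le> \<theta> b"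
        "?c < len v"
      then have "n = 0"
        using turns[of n] \<theta>_diff[OF \<open>v \<in> V\<close> a] \<theta>_diff[OF b \<open>v \<in> V\<close>] v(4,5)
        by (elim disjE conjE) linarith+
      moreover have "\<theta> v \<noteq> \<theta> a" "\<theta> v \<noteq> \<theta> b"
        using v a b by (simp_all add: \<theta>_eq_iff)
      ultimately show "v \<in> between a b \<inter> longer a b"
        using v less by (auto simp: between_def longer_def)
    qed (use less \<theta>_diff[OF b a] in \<open>auto simp: between_def intro!: exI[of _ 0]\<close>)
  next
    assume card: "card (beyond a b \<inter> longer a b) \<le> k"
    show ?thesis
    \<comment> \<open>The complementary arc runs from \<open>b\<close> to the next lift of
      \<open>a\<close>; it is shorter than a full turn because
      \<open>\<theta> a < \<theta> b\<close>.\<close>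
    proof (rule adjacent[OF card, of "\<theta> b" "\<theta> a + 2 * pi"])
      fix v and n :: int
      assume v: "v \<in> V" "v \<noteq> a" "v \<noteq> b" "\<theta> b \<le> \<theta> v + 2 * pi * n"
        "\<theta> v + 2 * pi * n \<le> \<theta> a + 2 * pi" "?c < len v"
      have ne: "\<theta> v \<noteq> \<theta> a" "\<theta> v \<noteq> \<theta> b"
        using v a b by (simp_all add: \<theta>_eq_iff)
      have "\<theta> v \<le> \<theta> a" if "\<theta> v < \<theta> b"
        using turns[of n] v(4,5) that pi_gt_zero by (elim disjE conjE) (simp, linarith+)
      then have "\<theta> v < \<theta> a \<or> \<theta> b < \<theta> v"
        using ne by linarith
      then show "v \<in> beyond a b \<inter> longer a b"
        using v less by (auto simp: beyond_def longer_def)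
    next
      show "\<exists>n::int. \<theta> b \<le> \<theta> a + 2 * pi * n \<and> \<theta> a + 2 * pi * n \<le> \<theta> a + 2 * pi"
        using \<theta>_diff[OF b a] by (intro exI[of _ 1]) auto
      show "\<exists>n::int. \<theta> b \<le> \<theta> b + 2 * pi * n \<and> \<theta> b + 2 * pi * n \<le> \<theta> a + 2 * pi"
        using \<theta>_diff[OF b a] by (intro exI[of _ 0]) auto
    qed (use less \<theta>_diff[OF b a] in \<open>auto simp: beyond_def\<close>)
  qed
qed

lemma visible_iff:
  assumes "a \<in> V" "b \<in> V" "a \<noteq> b"
  shows "{a, b} \<in> E \<longleftrightarrow>
    card (between a b \<inter> longer a b) \<le> k \<or> card (beyond a b \<inter> longer a b) \<le> k"
proof -
  have "\<theta> a < \<theta> b \<or> \<theta> b < \<theta> a"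
    using \<theta>_eq_iff assms by force
  then show ?thesis
    using visible_iff_if_less[of a b] visible_iff_if_less[of b a] assms
    by (auto simp: insert_commute between_commute beyond_commute longer_commute)
qed

section \<open>Crossing of chords and interlacing of endpoints\<close>

text \<open>In the product form each factor has the sign of an angle difference, so the sign is that
  of \<open>(\<theta> x - \<theta> b) * (\<theta> x - \<theta> a)\<close>.\<close>

lemma orient_sign:
  assumes "a \<in> V" "b \<in> V" "\<theta> a < \<theta> b" "x \<in> V"
  shows "orient (p a) (p b) (p x) < 0 \<longleftrightarrow> x \<in> between a b"
    and "orient (p a) (p b) (p x) > 0 \<longleftrightarrow> x \<in> beyond a b"
proof -
  have pos: "0 < sin ((\<theta> u - \<theta> v) / 2)" if "u \<in> V" "v \<in> V" "\<theta> v < \<theta> u" for u v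
    using that \<theta>_diff[OF that(1,2)] by (intro sin_gt_zero) auto
  have neg: "sin ((\<theta> u - \<theta> v) / 2) < 0" if "u \<in> V" "v \<in> V" "\<theta> u < \<theta> v" for u v
    using pos[OF that(2,1,3)] sin_minus[of "(\<theta> v - \<theta> u) / 2"] by (simp add: minus_divide_left)
  have eq: "orient (p a) (p b) (p x) =
      4 * sin ((\<theta> b - \<theta> a) / 2) * (sin ((\<theta> x - \<theta> b) / 2) * sin ((\<theta> x - \<theta> a) / 2))"
    using assms by (simp add: p_eq orient_circle_point)
  have "4 * sin ((\<theta> b - \<theta> a) / 2) > 0"
    using pos assms by simp
  then have signs: "orient (p a) (p b) (p x) < 0 \<longleftrightarrow>
      sin ((\<theta> x - \<theta> b) / 2) * sin ((\<theta> x - \<theta> a) / 2) < 0"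
    "orient (p a) (p b) (p x) > 0 \<longleftrightarrow> sin ((\<theta> x - \<theta> b) / 2) * sin ((\<theta> x - \<theta> a) / 2) > 0"
    unfolding eq by (simp_all only: mult_less_0_iff zero_less_mult_iff) auto
  consider "\<theta> x < \<theta> a" | "\<theta> x = \<theta> a" | "\<theta> a < \<theta> x" "\<theta> x < \<theta> b" | "\<theta> x = \<theta> b" | "\<theta> b < \<theta> x"
    by linarith
  then have "(orient (p a) (p b) (p x) < 0 \<longleftrightarrow> x \<in> between a b) \<and>
    (orient (p a) (p b) (p x) > 0 \<longleftrightarrow> x \<in> beyond a b)"
  proof cases
    case 1
    then have "sin ((\<theta> x - \<theta> b) / 2) < 0" "sin ((\<theta> x - \<theta> a) / 2) < 0"
      using neg assms by auto
    then show ?thesis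
      unfolding signs using 1 assms
      by (auto simp: mult_less_0_iff zero_less_mult_iff between_def beyond_def)
  next
    case 3
    then have "sin ((\<theta> x - \<theta> b) / 2) < 0" "sin ((\<theta> x - \<theta> a) / 2) > 0"
      using neg pos assms by auto
    then show ?thesis
      unfolding signs using 3 assms
      by (auto simp: mult_less_0_iff zero_less_mult_iff between_def beyond_def)
  next
    case 5
    then have "sin ((\<theta> x - \<theta> b) / 2) > 0" "sin ((\<theta> x - \<theta> a) / 2) > 0"
      using pos assms by auto
    then show ?thesis
      unfolding signs using 5 assms
      by (auto simp: mult_less_0_iff zero_less_mult_iff between_def beyond_def)
  qed (use assms in \<open>auto simp: signs between_def beyond_def\<close>)
  then show "orient (p a) (p b) (p x) < 0 \<longleftrightarrow> x \<in> between a b"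
    and "orient (p a) (p b) (p x) > 0 \<longleftrightarrow> x \<in> beyond a b"
    by blast+
qed

text \<open>Interlacing endpoints put \<open>c\<close> and \<open>d\<close> on opposite sides of the
  line through \<open>a\<close> and \<open>b\<close>, and vice versa.\<close>

lemma crossI:
  assumes "a \<in> V" "b \<in> V" "c \<in> V" "d \<in> V" "\<theta> a < \<theta> c" "\<theta> c < \<theta> b" "\<theta> b < \<theta> d"
  shows "edges_cross p {a, b} {c, d}"
  unfolding edges_cross_doubleton
proof (rule open_segments_meet)
  have "orient (p a) (p b) (p c) < 0" "orient (p a) (p b) (p d) > 0"
    "orient (p c) (p d) (p a) > 0" "orient (p c) (p d) (p b) < 0"
    using assms by (simp_all add: orient_sign) (auto simp: between_def beyond_def)
  then show "orient (p a) (p b) (p c) * orient (p a) (p b) (p d) < 0"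
    "orient (p c) (p d) (p a) * orient (p c) (p d) (p b) < 0"
    by (simp_all add: mult_less_0_iff)
qed

text \<open>At a crossing point the affine function \<open>orient (p a) (p b)\<close> is zero and is
  a strict weighted mean of its values at \<open>c\<close> and \<open>d\<close>. These are of
  opposite sign or both zero; the latter would put \<open>c\<close> and \<open>d\<close> on the line
  through \<open>a\<close> and \<open>b\<close>, forcing the two edges to coincide.\<close>

lemma crossD:
  assumes V: "a \<in> V" "b \<in> V" "c \<in> V" "d \<in> V" and "a \<noteq> b" "c \<noteq> d" "{a, b} \<noteq> {c, d}"
    and cross: "edges_cross p {a, b} {c, d}"
  shows "c \<in> between a b \<and> d \<in> beyond a b \<or> d \<in> between a b \<and> c \<in> beyond a b"
proof -
  have *: "c \<in> between a b \<and> d \<in> beyond a b \<or> d \<in> between a b \<and> c \<in> beyond a b"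
    if V: "a \<in> V" "b \<in> V" and less: "\<theta> a < \<theta> b" and ne: "{a, b} \<noteq> {c, d}"
      and "edges_cross p {a, b} {c, d}" for a b
  proof -
    have "open_segment (p a) (p b) \<inter> open_segment (p c) (p d) \<noteq> {}"
      using that by (simp add: edges_cross_doubleton)
    then obtain X where "X \<in> open_segment (p a) (p b)" "X \<in> open_segment (p c) (p d)"
      by blast
    then obtain s t where "0 < s" "s < 1"
      and eq: "(1 - t) *\<^sub>R p a + t *\<^sub>R p b = (1 - s) *\<^sub>R p c + s *\<^sub>R p d"
      unfolding in_segment by metis
    have "orient (p a) (p b) (p a) = 0" "orient (p a) (p b) (p b) = 0"
      by (simp_all add: orient_def algebra_simps)
    then have zero: "(1 - s) * orient (p a) (p b) (p c) + s * orient (p a) (p b) (p d) = 0"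
      using orient_affine[of "p a" "p b" t "p a" "p b"] orient_affine[of "p a" "p b" s "p c" "p d"]
      by (simp add: eq)
    have "orient (p a) (p b) (p c) \<noteq> 0 \<or> orient (p a) (p b) (p d) \<noteq> 0"
    proof (rule ccontr)
      \<comment> \<open>A line through two points of the circle contains no third one.\<close>
      have on_line: "x \<in> {a, b}" if "orient (p a) (p b) (p x) = 0" "x \<in> V" for x
      proof -
        have "x \<notin> between a b" "x \<notin> beyond a b"
          using orient_sign[OF V less \<open>x \<in> V\<close>] that by auto
        then show ?thesis
          using that V less \<theta>_eq_iff by (fastforce simp: between_def beyond_def)
      qed
      assume "\<not> ?thesis"
      then have "c \<in> {a, b}" "d \<in> {a, b}"
        using on_line assms by blast+
      then show False
        using ne \<open>c \<noteq> d\<close> by auto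
    qed
    moreover have "x < 0 \<and> 0 < y \<or> y < 0 \<and> 0 < x"
      if sum: "(1 - s) * x + s * y = 0" and nz: "x \<noteq> 0 \<or> y \<noteq> 0" for x y
    proof -
      consider "0 < x" "0 \<le> y" | "0 \<le> x" "0 < y" | "x < 0" "y \<le> 0" | "x \<le> 0" "y < 0"
        | "x < 0 \<and> 0 < y \<or> y < 0 \<and> 0 < x"
        using nz by linarith
      then show ?thesis
      proof cases
        case 1
        then have "0 < (1 - s) * x" "0 \<le> s * y" using \<open>0 < s\<close> \<open>s < 1\<close> by simp_all
        then show ?thesis using sum by linarith
      next
        case 2
        then have "0 \<le> (1 - s) * x" "0 < s * y" using \<open>0 < s\<close> \<open>s < 1\<close> by simp_all
        then show ?thesis using sum by linarith
      next
        case 3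
        then have "(1 - s) * x < 0" "s * y \<le> 0" using \<open>0 < s\<close> \<open>s < 1\<close>
          by (simp_all add: mult_less_0_iff mult_le_0_iff)
        then show ?thesis using sum by linarith
      next
        case 4
        then have "(1 - s) * x \<le> 0" "s * y < 0" using \<open>0 < s\<close> \<open>s < 1\<close>
          by (simp_all add: mult_less_0_iff mult_le_0_iff)
        then show ?thesis using sum by linarith
      qed
    qed
    ultimately show ?thesis
      using zero orient_sign[OF V less \<open>c \<in> V\<close>] orient_sign[OF V less \<open>d \<in> V\<close>] by blast
  qed
  have "\<theta> a < \<theta> b \<or> \<theta> b < \<theta> a"
    using \<theta>_eq_iff assms by force
  then show ?thesis
    using *[of a b] *[of b a] assms
    by (metis between_commute beyond_commute insert_commute)
qed

section \<open>Quasiplanarity\<close>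

lemma no_pairwise_crossing: "\<not> has_pairwise_crossing (k + 2) p E"
proof
  assume "has_pairwise_crossing (k + 2) p E"
  then obtain F where F: "F \<subseteq> E" "card F = k + 2" "pairwise (edges_cross p) F"
    by (auto simp: has_pairwise_crossing_def)
  have "finite F"
    using F(2) by (simp add: card_ge_0_finite)
  have sub: "e \<subseteq> V" "e \<noteq> {}" if "e \<in> F" for e
    using F(1) that by (auto elim: edge_cases)
  have "F \<noteq> {}"
    using F(2) by auto
  have "finite (\<Union>F)" "\<Union>F \<noteq> {}"
    using sub \<open>F \<noteq> {}\<close> finite_V by (fastforce intro: finite_subset[of _ V])+
  then obtain v where v: "v \<in> \<Union>F" and min: "\<And>u. u \<in> \<Union>F \<Longrightarrow> len v \<le> len u"
    using arg_min_if_finite(1)[of "\<Union>F" len] arg_min_least[of "\<Union>F" _ len] by blast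
  then obtain e where e: "e \<in> F" "v \<in> e"
    by blast
  then obtain w where w: "e = {v, w}" "v \<in> V" "w \<in> V" "v \<noteq> w"
    using F(1) edge_at[of e v] by blast
  have len_less: "len v < len x" if "x \<in> \<Union>F" "x \<noteq> v" for x
  proof -
    have "x \<in> V"
      using that(1) sub by blast
    then have "len x \<noteq> len v"
      using inj_len w that(2) by (auto simp: inj_on_def)
    then show ?thesis
      using min[OF that(1)] by simp
  qed
  have split: "\<exists>x y. x \<in> e' \<inter> between v w \<and> y \<in> e' \<inter> beyond v w" if e': "e' \<in> F - {e}" for e'
  proof -
    obtain c d where cd: "e' = {c, d}" "c \<in> V" "d \<in> V" "c \<noteq> d"
      using e' F(1) edge_cases[of e'] by blast
    moreover have "edges_cross p e e'"
      using pairwiseD[OF F(3), of e e'] e' e(1) by blast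
    ultimately show ?thesis
      using crossD[of v w c d] e' w by auto
  qed
  then obtain g h where g: "\<And>e'. e' \<in> F - {e} \<Longrightarrow> g e' \<in> e' \<inter> between v w"
    and h: "\<And>e'. e' \<in> F - {e} \<Longrightarrow> h e' \<in> e' \<inter> beyond v w"
    by metis
  \<comment> \<open>Crossing edges share no endpoint, since an end of a chord lies on neither of its
    open arcs. Endpoints picked from different edges of \<open>F\<close> are therefore
    different.\<close>
  have disj: "x \<notin> e2" if es: "e1 \<in> F" "e2 \<in> F" "e1 \<noteq> e2" "x \<in> e1" for e1 e2 x
  proof
    assume "x \<in> e2"
    obtain a where a: "e1 = {x, a}" "x \<in> V" "a \<in> V" "x \<noteq> a"
      using F(1) es edge_at[of e1 x] by blast
    obtain b where b: "e2 = {x, b}" "b \<in> V" "x \<noteq> b"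
      using F(1) es \<open>x \<in> e2\<close> edge_at[of e2 x] by blast
    have "edges_cross p e1 e2"
      using pairwiseD[OF F(3) es(1-3)] .
    then show False
      using crossD[of x a x b] a b es by (auto simp: between_def beyond_def)
  qed
  \<comment> \<open>Picking one endpoint in \<open>S\<close> from each of the \<open>k + 1\<close>
    edges other than \<open>e\<close> is injective.\<close>
  have large: "k < card S" if "\<And>e'. e' \<in> F - {e} \<Longrightarrow> f e' \<in> e' \<inter> S" "S \<subseteq> V" for f S
  proof -
    have "inj_on f (F - {e})"
    proof (rule inj_onI, rule ccontr)
      fix e1 e2 assume "e1 \<in> F - {e}" "e2 \<in> F - {e}" "f e1 = f e2" "e1 \<noteq> e2"
      then show False
        using disj[of e1 e2 "f e1"] that(1)[of e1] that(1)[of e2] by auto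
    qed
    then have "card (F - {e}) \<le> card S"
      using that finite_V by (intro card_inj_on_le[of f]) (auto intro: finite_subset)
    then show ?thesis
      using F(2) e(1) by simp
  qed
  have long: "x \<in> longer v w" if "e' \<in> F" "x \<in> e'" "x \<in> V" "x \<noteq> v" for e' x
    using that(3) len_less[OF UnionI[OF that(1,2)] that(4)]
    by (simp add: longer_def min_less_iff_disj)
  have sides: "between v w \<subseteq> V - {v}" "beyond v w \<subseteq> V - {v}"
    by (auto simp: between_def beyond_def)
  have "k < card (between v w \<inter> longer v w)"
  proof (rule large[of g])
    fix e' assume "e' \<in> F - {e}"
    then show "g e' \<in> e' \<inter> (between v w \<inter> longer v w)"
      using g[of e'] long[of e' "g e'"] sides by blast
  qed (use sides in blast)
  moreover have "k < card (beyond v w \<inter> longer v w)"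
  proof (rule large[of h])
    fix e' assume "e' \<in> F - {e}"
    then show "h e' \<in> e' \<inter> (beyond v w \<inter> longer v w)"
      using h[of e'] long[of e' "h e'"] sides by blast
  qed (use sides in blast)
  ultimately show False
    using visible_iff[OF w(2-4)] F(1) e w by auto
qed

section \<open>Maximality\<close>

text \<open>The assumption \<open>\<theta> a = \<tau>\<close> cuts the circle at the shorter bar, so
  increasing angle is the cyclic order starting from \<open>a\<close>.\<close>

lemma nonadjacent_crossing:
  assumes a: "a \<in> V" and b: "b \<in> V" and less: "len a < len b" and nonadj: "{a, b} \<notin> E"
    and base: "\<theta> a = \<tau>"
  shows "has_pairwise_crossing (k + 2) p (insert {a, b} E)"
proof -
  define T where "T = {v \<in> V. len a < len v}"
  define m where "m = card T"
  have T: "T \<subseteq> V" "finite T" "b \<in> T" "a \<notin> T"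
    using finite_V b less by (auto simp: T_def)
  have a_least: "\<theta> a < \<theta> v" if "v \<in> T" for v
    using that \<theta>_ge[of v] \<theta>_eq_iff[of a v] a base T by force
  have inj_T: "inj_on \<theta> T"
    using \<theta>_inj T(1) by (rule inj_on_subset)
  have "card (\<theta> ` T) = m"
    using inj_T by (simp add: card_image m_def)
  define h where "h = (!) (sorted_list_of_set (\<theta> ` T))"
  have h: "bij_betw h {..<m} (\<theta> ` T)"
    unfolding h_def using T \<open>card (\<theta> ` T) = m\<close> by (intro bij_betw_nth) simp_all
  have h_less: "h i < h j" if "i < j" "j < m" for i j
    unfolding h_def using that \<open>card (\<theta> ` T) = m\<close>
    by (intro sorted_wrt_nth_less[OF strict_sorted_list_of_set]) simp_all
  \<comment> \<open>\<open>h\<close> lists the angles of the longer bars in increasing order;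
    \<open>t\<close> lists the bars themselves.\<close>
  define t where "t = inv_into T \<theta> \<circ> h"
  have bij: "bij_betw t {..<m} T"
    unfolding t_def using h inj_T
    by (intro bij_betw_trans[of _ _ "\<theta> ` T"]) (simp_all add: bij_betw_inv_into inj_on_imp_bij_betw)
  have \<theta>_t: "\<theta> (t i) = h i" if "i < m" for i
    using bij_betwE[OF h] that by (simp add: t_def f_inv_into_f)
  have t_less: "\<theta> (t i) < \<theta> (t j)" if "i < j" "j < m" for i j
    using that h_less by (simp add: \<theta>_t)
  have t_less_iff: "\<theta> (t i) < \<theta> (t j) \<longleftrightarrow> i < j" if "i < m" "j < m" for i j
    using t_less[of i j] t_less[of j i] that by (metis linorder_neqE_nat order_less_asym)
  have t_T: "t i \<in> T" if "i < m" for i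
    using bij that by (auto simp: bij_betw_def)
  then have t_V: "t i \<in> V" if "i < m" for i
    using that T by blast
  have t_onto: "\<exists>i<m. v = t i" if "v \<in> T" for v
    using bij that by (auto simp: bij_betw_def)
  \<comment> \<open>With \<open>b\<close> at position \<open>j\<close>, exactly \<open>j\<close>
    longer bars lie before it and \<open>m - Suc j\<close> after it. Non-adjacency makes both
    numbers exceed \<open>k\<close>.\<close>
  then obtain j where j: "j < m" "b = t j"
    using T by blast
  have "a \<noteq> b"
    using less by auto
  have many: "k < card (between a b \<inter> longer a b)" "k < card (beyond a b \<inter> longer a b)"
    using visible_iff[OF a b \<open>a \<noteq> b\<close>] nonadj by auto
  have longer_T: "longer a b = T"
    using less by (auto simp: longer_def T_def)
  have "between a b \<inter> longer a b \<subseteq> t ` {..<j}"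
  proof
    fix v assume v: "v \<in> between a b \<inter> longer a b"
    then obtain i where i: "i < m" "v = t i"
      using t_onto longer_T by blast
    then show "v \<in> t ` {..<j}"
      using v j a_least[OF T(3)] t_less_iff by (auto simp: between_def)
  qed
  then have "card (between a b \<inter> longer a b) \<le> j"
    using surj_card_le[of "{..<j}"] by fastforce
  then have kj: "k < j"
    using many by simp
  have "beyond a b \<inter> longer a b \<subseteq> t ` {j<..<m}"
  proof
    fix v assume v: "v \<in> beyond a b \<inter> longer a b"
    then obtain i where i: "i < m" "v = t i" "\<theta> a < \<theta> v"
      using t_onto longer_T a_least by blast
    then show "v \<in> t ` {j<..<m}"
      using v j a_least[OF T(3)] t_less_iff by (auto simp: beyond_def)
  qed
  then have "card (beyond a b \<inter> longer a b) \<le> m - Suc j"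
    using surj_card_le[of "{j<..<m}"] by fastforce
  then have jm: "j + k + 1 < m"
    using many by simp
  \<comment> \<open>\<open>q\<close> is the index of the first of the last \<open>k + 1\<close>
    longer bars. By \<open>k < j < q\<close> the first \<open>k + 1\<close> of them precede
    \<open>b\<close> and the last \<open>k + 1\<close> follow it.\<close>
  define q where "q = m - k - 1"
  have q: "j < q" "q + k + 1 = m"
    using jm by (auto simp: q_def)
  define e where "e i = {t i, t (q + i)}" for i
  have e_edge: "e i \<in> E" if "i \<le> k" for i
  proof -
    have i: "i < m" "q + i < m" "i < q + i"
      using that kj q by auto
    \<comment> \<open>On the arc through \<open>a\<close>, only the \<open>i\<close> longer bars
      before \<open>t i\<close> and the \<open>k - i\<close> after \<open>t (q + i)\<close> can
      block, hence at most \<open>k\<close>. The bar \<open>a\<close> itself is too short to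
      count.\<close>
    have "beyond (t i) (t (q + i)) \<inter> longer (t i) (t (q + i)) \<subseteq> t ` ({..<i} \<union> {q + i<..<m})"
    proof
      fix v assume v: "v \<in> beyond (t i) (t (q + i)) \<inter> longer (t i) (t (q + i))"
      then have "v \<in> T"
        using t_T[OF i(1)] t_T[OF i(2)] by (auto simp: T_def longer_def)
      then obtain l where l: "l < m" "v = t l"
        using t_onto by blast
      then show "v \<in> t ` ({..<i} \<union> {q + i<..<m})"
        using v i t_less[OF i(3,2)] t_less_iff by (auto simp: beyond_def)
    qed
    then have "card (beyond (t i) (t (q + i)) \<inter> longer (t i) (t (q + i)))
        \<le> card ({..<i} \<union> {q + i<..<m})"
      by (intro surj_card_le) auto
    also have "\<dots> \<le> i + (m - Suc (q + i))"
      using card_Un_le[of "{..<i}" "{q + i<..<m}"] by simp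
    also have "\<dots> \<le> k"
      using q that by simp
    finally show ?thesis
      unfolding e_def using visible_iff[OF t_V[OF i(1)] t_V[OF i(2)]] t_less[OF i(3,2)] by force
  qed
  have t_eq_iff: "t i = t i' \<longleftrightarrow> i = i'" if "i < m" "i' < m" for i i'
    using bij that by (auto simp: bij_betw_def inj_on_def)
  have e_inj: "inj_on e {..k}"
  proof (rule inj_onI)
    fix i i' assume "i \<in> {..k}" "i' \<in> {..k}" "e i = e i'"
    then show "i = i'"
      using q kj by (auto simp: e_def doubleton_eq_iff t_eq_iff)
  qed
  have ab: "{a, b} \<notin> e ` {..k}"
    using e_edge nonadj by auto
  \<comment> \<open>Since \<open>i' \<le> k < q\<close>, the order is \<open>t i\<close>,
    \<open>t i'\<close>, \<open>t (q + i)\<close>, \<open>t (q + i')\<close>.\<close>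
  have cross_less: "edges_cross p (e i) (e i')" if "i < i'" "i' \<le> k" for i i'
    unfolding e_def using that q kj by (intro crossI t_V t_less) auto
  \<comment> \<open>Here \<open>i < j < q + i\<close>, so the order is \<open>a\<close>,
    \<open>t i\<close>, \<open>b\<close>, \<open>t (q + i)\<close>.\<close>
  have cross_ab: "edges_cross p {a, b} (e i)" if "i \<le> k" for i
    unfolding e_def j using that q kj by (intro crossI t_V t_less a a_least t_T) auto
  have "pairwise (edges_cross p) (e ` {..k})"
  proof (rule pairwiseI)
    fix x y assume "x \<in> e ` {..k}" "y \<in> e ` {..k}" "x \<noteq> y"
    then obtain i i' where ii': "x = e i" "y = e i'" "i \<le> k" "i' \<le> k"
      by blast
    then have "i < i' \<or> i' < i"
      using \<open>x \<noteq> y\<close> by (metis linorder_neqE_nat)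
    with ii' show "edges_cross p x y"
      using cross_less edges_cross_commute by blast
  qed
  then have "pairwise (edges_cross p) (insert {a, b} (e ` {..k}))"
    using cross_ab edges_cross_commute by (auto simp: pairwise_insert)
  moreover have "card (insert {a, b} (e ` {..k})) = k + 2"
    using ab e_inj by (simp add: card_image)
  moreover have "insert {a, b} (e ` {..k}) \<subseteq> insert {a, b} E"
    using e_edge by auto
  ultimately show ?thesis
    unfolding has_pairwise_crossing_def by blast
qed

end

section \<open>Choice of angles and conclusion\<close>

text \<open>Take polar angles in one turn starting at 0 and raise those below the angle of
  \<open>a\<close> by a full turn; the window then starts at \<open>a\<close>.\<close>

lemma angles_from_base:
  assumes "\<And>v. v \<in> V \<Longrightarrow> (fst (p v))\<^sup>2 + (snd (p v))\<^sup>2 = 1" and "a \<in> V"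
  obtains \<theta> where "\<And>v. v \<in> V \<Longrightarrow> p v = circle_point (\<theta> v)"
    "\<And>v. v \<in> V \<Longrightarrow> \<theta> a \<le> \<theta> v" "\<And>v. v \<in> V \<Longrightarrow> \<theta> v < \<theta> a + 2 * pi"
proof -
  have "\<exists>t. 0 \<le> t \<and> t < 2 * pi \<and> p v = circle_point t" if "v \<in> V" for v
    using sincos_total_2pi[OF assms(1)[OF that]] by (metis prod.collapse)
  then obtain \<phi> where \<phi>: "\<And>v. v \<in> V \<Longrightarrow> 0 \<le> \<phi> v \<and> \<phi> v < 2 * pi \<and> p v = circle_point (\<phi> v)"
    by metis
  define \<theta> where "\<theta> v = (if \<phi> v < \<phi> a then \<phi> v + 2 * pi else \<phi> v)" for v
  show thesis
    by (rule that[of \<theta>]) (use \<phi> \<phi>[OF \<open>a \<in> V\<close>] in \<open>force simp: \<theta>_def\<close>)+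
qed

theorem theorem4:
  fixes k :: nat and V :: "'a set" and E :: "'a set set"
  assumes "simple_graph V E"
    and "\<exists>p len. cyl_semi_bar_visibility_rep k V E p len \<and> inj_on len V"
  shows "\<exists>f. maximal_quasiplanar_convex_rep (k + 2) V E f"
proof -
  obtain p len where rep: "cyl_semi_bar_visibility_rep k V E p len" and inj: "inj_on len V"
    using assms(2) by blast
  have unit: "\<And>v. v \<in> V \<Longrightarrow> (fst (p v))\<^sup>2 + (snd (p v))\<^sup>2 = 1"
    using rep by (simp add: cyl_semi_bar_visibility_rep_def)
  \<comment> \<open>The drawing \<open>p\<close> stays fixed while the circle may be recut at any
    vertex: maximality needs the cut at the shorter bar of each non-adjacent pair.\<close>
  have angles: "\<exists>\<theta>. visibility_angles k V E p len \<theta> (\<theta> a)" if a: "a \<in> V" for a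
  proof -
    obtain \<theta> where "\<And>v. v \<in> V \<Longrightarrow> p v = circle_point (\<theta> v)"
      "\<And>v. v \<in> V \<Longrightarrow> \<theta> a \<le> \<theta> v" "\<And>v. v \<in> V \<Longrightarrow> \<theta> v < \<theta> a + 2 * pi"
      using angles_from_base[of V p a] unit a by blast
    then show ?thesis
      using assms(1) rep inj unfolding visibility_angles_def by blast
  qed
  have "inj_on p V \<and> \<not> has_pairwise_crossing (k + 2) p E"
  \<comment> \<open>A cut needs a vertex to start from, so the empty graph is treated
    separately.\<close>
  proof (cases "V = {}")
    case True
    then have "E = {}"
      using assms(1) by (auto simp: simple_graph_def)
    then show ?thesis
      using True by (auto simp: has_pairwise_crossing_def)
  next
    case False
    then obtain a \<theta> where "visibility_angles k V E p len \<theta> (\<theta> a)"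
      using angles by blast
    then show ?thesis
      using visibility_angles.p_inj visibility_angles.no_pairwise_crossing by blast
  qed
  moreover have "convex_position (p ` V)"
    using unit by (intro convex_position_unit_circle) auto
  moreover have "has_pairwise_crossing (k + 2) p (insert {a, b} E)"
    if ab: "a \<in> V" "b \<in> V" "a \<noteq> b" "{a, b} \<notin> E" for a b
  proof -
    have crossing: "has_pairwise_crossing (k + 2) p (insert {a, b} E)"
      if "a \<in> V" "b \<in> V" "{a, b} \<notin> E" "len a < len b" for a b
      using angles[OF that(1)] visibility_angles.nonadjacent_crossing[OF _ that(1,2,4,3)] by blast
    have "len a < len b \<or> len b < len a"
      using inj ab by (meson inj_onD linorder_neqE)
    then show ?thesis
      using crossing[of a b] crossing[of b a] ab by (auto simp: insert_commute)
  qed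
  ultimately show ?thesis
    unfolding maximal_quasiplanar_convex_rep_def quasiplanar_convex_rep_def by blast
qed

end
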